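(* Let $A$ be the affine space over a finite-dimensional real quadratic space $(V,Q)$, where $Q$ is a non-degenerate quadratic form of signature $(p,q)$. Let $\mathcal{T}$ be the translation group acting on $A$, and let $G=\mathcal{T}\rtimes O(p,q)$ be the isometry group of $A$. Then, for direct and indirect isometries of $G$: (i) The isometries of the orthogonal group $O(p,q)$ acting on $A$ are classified as follows. Let $h = r_1 r_2\cdots r_k$ be a product of reflections of $O(p,q)$, with supporting vectors $u_1,\dots,u_k$. (a) If $k$ is odd, $h$ is an indirect isometry. (b) If $k$ is even and an even number of the $Q(u_i)$ are negative (the others being positive), $h$ is a direct isometry. (c) If $k$ is even and an odd number of the $Q(u_i)$ are negative (the others being positive), $h$ is an indirect isometry. (ii) The translations of $\mathcal{T}$ are direct isometries. (iii) The compositions of isometries of $O(p,q)$ with translations are also classified by (a), (b), (c): composing $h=r_1\cdots r_k\in O(p,q)$ on the left or on the right with translations gives an isometry which is direct or indirect according to (a), (b), (c) applied to $h$.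
   Context: An element of an isometry group $\Gamma$ is called a direct isometry of $\Gamma$ when it can be expressed as a (finite) product of squares of elements of $\Gamma$; otherwise it is an indirect isometry of $\Gamma$. Isometries here are transformations preserving the intervals $S_{x,y}$ defined by $S_{x,y}^2=Q(x-y)$ (a quantity which may be positive, negative or null). $O(p,q)$ is the orthogonal group of $(V,Q)$, acting linearly. The vector orthogonal to the hyperplane of a reflection is called the supporting vector of the reflection (defined up to a nonzero scalar); its square is the value of $Q$ on it, which is never null. An origin being fixed, $A$ is identified with $V$; in $G=\mathcal{T}\rtimes O(p,q)$, $h\in O(p,q)$ acts on $\mathcal{T}$ by conjugation, i.e. it sends the translation of vector $t$ to the translation of vector $h(t)$. Elements of $\mathcal{T}$ and $O(p,q)$ are identified with their images in $G$. *)

theory Defs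
  imports "HOL-Analysis.Analysis" "HOL-Algebra.Coset"
begin

section \<open>Real quadratic spaces\<close>

definition polar :: "('v::real_vector \<Rightarrow> real) \<Rightarrow> 'v \<Rightarrow> 'v \<Rightarrow> real" where
  "polar Q x y = (Q (x + y) - Q x - Q y) / 2"

definition quadratic_form :: "('v::real_vector \<Rightarrow> real) \<Rightarrow> bool" where
  "quadratic_form Q \<longleftrightarrow> (\<forall>c x. Q (c *\<^sub>R x) = c\<^sup>2 * Q x) \<and> bilinear (polar Q)"

definition nondegenerate :: "('v::real_vector \<Rightarrow> real) \<Rightarrow> bool" where
  "nondegenerate Q \<longleftrightarrow> (\<forall>x. (\<forall>y. polar Q x y = 0) \<longrightarrow> x = 0)"

text \<open>The numbers of positive and of negative vectors in an orthogonal basis; by Sylvester's law of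
  inertia they do not depend on the basis. Null basis vectors are allowed, so this does not
  by itself imply non-degeneracy.\<close>
definition has_signature :: "('v::real_vector \<Rightarrow> real) \<Rightarrow> nat \<Rightarrow> nat \<Rightarrow> bool" where
  "has_signature Q p q \<longleftrightarrow>
     (\<exists>B. finite B \<and> independent B \<and> span B = UNIV \<and> pairwise (\<lambda>x y. polar Q x y = 0) B \<and>
          card {x \<in> B. Q x > 0} = p \<and> card {x \<in> B. Q x < 0} = q)"


section \<open>Isometries\<close>

text \<open>The affine space is identified with the vector space by the choice of an origin. An isometry is a
  bijection that preserves \<open>Q (x - y)\<close>, the square of the interval. It is not assumed to be
  affine; that it is a linear isometry followed by a translation is proved below.\<close>
definition isometry_group :: "('v::real_vector \<Rightarrow> real) \<Rightarrow> ('v \<Rightarrow> 'v) monoid" where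
  "isometry_group Q =
     \<lparr>carrier = {f. bij f \<and> (\<forall>x y. Q (f x - f y) = Q (x - y))}, mult = (\<circ>), one = id\<rparr>"

definition orthogonal_group :: "('v::real_vector \<Rightarrow> real) \<Rightarrow> ('v \<Rightarrow> 'v) monoid" where
  "orthogonal_group Q =
     \<lparr>carrier = {h. linear h \<and> bij h \<and> (\<forall>x. Q (h x) = Q x)}, mult = (\<circ>), one = id\<rparr>"

definition translation_group :: "('v::real_vector \<Rightarrow> 'v) monoid" where
  "translation_group = \<lparr>carrier = range (+), mult = (\<circ>), one = id\<rparr>"

text \<open>The reflection with supporting vector \<open>u\<close>; meaningful only if \<open>Q u \<noteq> 0\<close>.\<close>
definition reflection :: "('v::real_vector \<Rightarrow> real) \<Rightarrow> 'v \<Rightarrow> 'v \<Rightarrow> 'v" where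
  "reflection Q u x = x - (2 * polar Q x u / Q u) *\<^sub>R u"

definition direct_isometry :: "('g, 'm) monoid_scheme \<Rightarrow> 'g \<Rightarrow> bool" where
  "direct_isometry \<Gamma> g \<longleftrightarrow>
     (\<exists>xs. set xs \<subseteq> carrier \<Gamma> \<and> g = foldr (mult \<Gamma>) (map (\<lambda>x. x \<otimes>\<^bsub>\<Gamma>\<^esub> x) xs) \<one>\<^bsub>\<Gamma>\<^esub>)"

definition indirect_isometry :: "('g, 'm) monoid_scheme \<Rightarrow> 'g \<Rightarrow> bool" where
  "indirect_isometry \<Gamma> g \<longleftrightarrow> g \<in> carrier \<Gamma> \<and> \<not> direct_isometry \<Gamma> g"


section \<open>Consistency of the definitions\<close>

context
  fixes Q :: "'v::real_vector \<Rightarrow> real"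
  assumes Q: "quadratic_form Q"
begin

lemma bilinear_polar: "bilinear (polar Q)"
  using Q by (simp add: quadratic_form_def)

lemmas polar_simps = bilinear_ladd[OF bilinear_polar] bilinear_radd[OF bilinear_polar]
  bilinear_lmul[OF bilinear_polar] bilinear_rmul[OF bilinear_polar]
  bilinear_lsub[OF bilinear_polar] bilinear_rsub[OF bilinear_polar]
  bilinear_lneg[OF bilinear_polar] bilinear_rneg[OF bilinear_polar]
  bilinear_lzero[OF bilinear_polar] bilinear_rzero[OF bilinear_polar]

lemma polar_commute: "polar Q x y = polar Q y x"
  by (simp add: polar_def add.commute)

lemma quadratic_form_scaleR: "Q (c *\<^sub>R x) = c\<^sup>2 * Q x"
  using Q by (simp add: quadratic_form_def)

lemma polar_self: "polar Q x x = Q x"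
  using quadratic_form_scaleR[of 2 x] by (simp add: polar_def scaleR_2)

lemma quadratic_form_0: "Q 0 = 0"
  using quadratic_form_scaleR[of 0 0] by simp

lemma quadratic_form_minus: "Q (- x) = Q x"
  using quadratic_form_scaleR[of "-1" x] by simp

lemma quadratic_form_add: "Q (x + y) = Q x + 2 * polar Q x y + Q y"
  by (simp add: polar_def field_simps)

lemma quadratic_form_diff: "Q (x - y) = Q x - 2 * polar Q x y + Q y"
  using quadratic_form_add[of x "-y"] by (simp add: polar_simps quadratic_form_minus)

lemma orthogonal_polar:
  assumes "h \<in> carrier (orthogonal_group Q)"
  shows "polar Q (h x) (h y) = polar Q x y"
  using assms by (simp add: orthogonal_group_def polar_def linear_add[symmetric])

lemma group_isometry_group: "group (isometry_group Q)"
proof (rule groupI)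
  fix f assume "f \<in> carrier (isometry_group Q)"
  then have f: "bij f" "\<And>x y. Q (f x - f y) = Q (x - y)"
    by (auto simp: isometry_group_def)
  have "Q (inv_into UNIV f x - inv_into UNIV f y) = Q (x - y)" for x y
    using f(2)[of "inv_into UNIV f x" "inv_into UNIV f y"] bij_is_surj[OF f(1)] by (simp add: surj_f_inv_f)
  then have "inv_into UNIV f \<in> carrier (isometry_group Q)"
    using f(1) by (simp add: isometry_group_def bij_imp_bij_inv)
  moreover have "inv_into UNIV f \<circ> f = id"
    using f(1) by (simp add: bij_is_inj)
  ultimately show "\<exists>g\<in>carrier (isometry_group Q). g \<otimes>\<^bsub>isometry_group Q\<^esub> f = \<one>\<^bsub>isometry_group Q\<^esub>"
    by (auto simp: isometry_group_def)
qed (auto simp: isometry_group_def comp_assoc intro: bij_comp)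

lemma subgroup_orthogonal: "subgroup (carrier (orthogonal_group Q)) (isometry_group Q)"
proof (rule group.subgroupI[OF group_isometry_group])
  show sub: "carrier (orthogonal_group Q) \<subseteq> carrier (isometry_group Q)"
    by (auto simp: orthogonal_group_def isometry_group_def linear_diff[symmetric])
  show "carrier (orthogonal_group Q) \<noteq> {}"
    using linear_id by (auto simp: orthogonal_group_def intro!: exI[of _ id])
  fix h assume h: "h \<in> carrier (orthogonal_group Q)"
  then have lin: "linear h" and bij: "bij h" and q: "\<And>x. Q (h x) = Q x"
    by (auto simp: orthogonal_group_def)
  have "Q (inv_into UNIV h x) = Q x" for x
    using q[of "inv_into UNIV h x"] bij_is_surj[OF bij] by (simp add: surj_f_inv_f)
  moreover have "linear (inv_into UNIV h)"
  proof (rule linearI)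
    have r: "h (inv_into UNIV h x) = x" for x
      using bij_is_surj[OF bij] by (simp add: surj_f_inv_f)
    show "inv_into UNIV h (x + y) = inv_into UNIV h x + inv_into UNIV h y" for x y
      by (rule inv_f_eq[OF bij_is_inj[OF bij]]) (simp add: linear_add[OF lin] r)
    show "inv_into UNIV h (c *\<^sub>R x) = c *\<^sub>R inv_into UNIV h x" for c x
      by (rule inv_f_eq[OF bij_is_inj[OF bij]]) (simp add: linear_cmul[OF lin] r)
  qed
  ultimately have *: "inv_into UNIV h \<in> carrier (orthogonal_group Q)"
    using bij by (simp add: orthogonal_group_def bij_imp_bij_inv)
  have "inv\<^bsub>isometry_group Q\<^esub> h = inv_into UNIV h"
    using bij h * sub by (intro group.inv_equality[OF group_isometry_group])
       (auto simp: isometry_group_def bij_is_inj)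
  then show "inv\<^bsub>isometry_group Q\<^esub> h \<in> carrier (orthogonal_group Q)"
    using * by simp
next
  fix g h assume "g \<in> carrier (orthogonal_group Q)" "h \<in> carrier (orthogonal_group Q)"
  then show "g \<otimes>\<^bsub>isometry_group Q\<^esub> h \<in> carrier (orthogonal_group Q)"
    by (auto simp: orthogonal_group_def isometry_group_def linear_compose intro: bij_comp)
qed

text \<open>The isometry group is the internal semidirect product of the translations, which form a normal
  subgroup, and the orthogonal group, which acts on the translations through
  \<open>h \<circ> (+) t = (+) (h t) \<circ> h\<close>.\<close>

lemma orthogonal_comp_translation:
  assumes "h \<in> carrier (orthogonal_group Q)"
  shows "h \<circ> (+) t = (+) (h t) \<circ> h"
  using assms by (auto simp: orthogonal_group_def linear_add)

lemma orthogonal_Int_translation: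
  "carrier (orthogonal_group Q) \<inter> carrier translation_group = {id}"
proof -
  have "(+) t = id" if "linear ((+) t)" for t :: 'v
    using linear_0[OF that] by auto
  moreover have "id = (+) (0::'v)" by auto
  ultimately show ?thesis
    using linear_id by (auto simp: orthogonal_group_def translation_group_def)
qed

lemma isometry_decomposition:
  assumes nd: "nondegenerate Q" and f: "f \<in> carrier (isometry_group Q)"
  shows "\<exists>h\<in>carrier (orthogonal_group Q). f = (+) (f 0) \<circ> h"
proof -
  from f have bij: "bij f" and q: "\<And>x y. Q (f x - f y) = Q (x - y)"
    by (auto simp: isometry_group_def)
  define h where "h x = f x - f 0" for x
  have hd: "Q (h x - h y) = Q (x - y)" for x y by (simp add: h_def q)
  have hq: "Q (h x) = Q x" for x using q[of x 0] by (simp add: h_def)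
  have hp: "polar Q (h x) (h y) = polar Q x y" for x y
    using hd[of x y] by (simp add: quadratic_form_diff hq)
  have bij_h: "bij h"
    using bij bij_comp[OF bij, of "\<lambda>x. x - f 0"] bij_plus_right[of "- f 0"]
    by (simp add: h_def[abs_def] comp_def)
  have zero: "z = 0" if "\<And>y. polar Q z (h y) = 0" for z
    using nd that bij_is_surj[OF bij_h] unfolding nondegenerate_def by (metis surjD)
  have "linear h"
  proof (rule linearI)
    fix x y
    have "h (x + y) - h x - h y = 0"
      by (rule zero) (simp add: polar_simps hp)
    then show "h (x + y) = h x + h y" by (simp add: algebra_simps)
  next
    fix c x
    have "h (c *\<^sub>R x) - c *\<^sub>R h x = 0"
      by (rule zero) (simp add: polar_simps hp)
    then show "h (c *\<^sub>R x) = c *\<^sub>R h x" by simp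
  qed
  then have "h \<in> carrier (orthogonal_group Q)"
    using bij_h hq by (simp add: orthogonal_group_def)
  moreover have "f = (+) (f 0) \<circ> h" by (auto simp: h_def)
  ultimately show ?thesis by blast
qed

lemma normal_translation:
  assumes nd: "nondegenerate Q"
  shows "normal (carrier translation_group) (isometry_group Q)"
proof -
  interpret group "isometry_group Q" by (rule group_isometry_group)
  have tr: "(+) t \<in> carrier (isometry_group Q)" for t
    by (simp add: isometry_group_def)
  have inv_tr: "inv\<^bsub>isometry_group Q\<^esub> ((+) t) = (+) (- t)" for t
    by (rule inv_equality[OF _ tr tr]) (auto simp: isometry_group_def)
  have "subgroup (carrier translation_group) (isometry_group Q)"
  proof (rule subgroupI)
    show "carrier translation_group \<subseteq> carrier (isometry_group Q)"
      using tr by (auto simp: translation_group_def)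
  next
    fix a b assume "a \<in> carrier (translation_group :: ('v \<Rightarrow> 'v) monoid)"
      "b \<in> carrier (translation_group :: ('v \<Rightarrow> 'v) monoid)"
    then obtain s t where "a = (+) s" "b = (+) t" by (auto simp: translation_group_def)
    then have "a \<otimes>\<^bsub>isometry_group Q\<^esub> b = (+) (s + t)"
      by (auto simp: isometry_group_def add.assoc)
    then show "a \<otimes>\<^bsub>isometry_group Q\<^esub> b \<in> carrier translation_group"
      by (simp add: translation_group_def)
  qed (auto simp: translation_group_def inv_tr)
  moreover have "f \<otimes>\<^bsub>isometry_group Q\<^esub> \<tau> \<otimes>\<^bsub>isometry_group Q\<^esub> inv\<^bsub>isometry_group Q\<^esub> f \<in> carrier translation_group"
    if f: "f \<in> carrier (isometry_group Q)" and \<tau>: "\<tau> \<in> carrier translation_group" for f \<tau>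
  proof -
    obtain t where t: "\<tau> = (+) t" using \<tau> by (auto simp: translation_group_def)
    obtain h where h: "h \<in> carrier (orthogonal_group Q)" and fh: "f = (+) (f 0) \<circ> h"
      using isometry_decomposition[OF nd f] by blast
    have lin: "linear h" using h by (simp add: orthogonal_group_def)
    have "f \<circ> (+) t = (+) (h t) \<circ> f"
      by (subst (1 2) fh) (auto simp: linear_add[OF lin])
    then have "f \<otimes>\<^bsub>isometry_group Q\<^esub> \<tau> = (+) (h t) \<otimes>\<^bsub>isometry_group Q\<^esub> f"
      by (simp add: isometry_group_def t)
    then have "f \<otimes>\<^bsub>isometry_group Q\<^esub> \<tau> \<otimes>\<^bsub>isometry_group Q\<^esub> inv\<^bsub>isometry_group Q\<^esub> f = (+) (h t)"
      using f tr[of "h t"] by (simp add: m_assoc)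
    then show ?thesis by (simp add: translation_group_def)
  qed
  ultimately show ?thesis by (simp add: normal_inv_iff)
qed

lemma translation_set_mult_orthogonal:
  assumes nd: "nondegenerate Q"
  shows "carrier translation_group <#>\<^bsub>isometry_group Q\<^esub> carrier (orthogonal_group Q)
         = carrier (isometry_group Q)"
proof
  interpret group "isometry_group Q" by (rule group_isometry_group)
  show "carrier translation_group <#>\<^bsub>isometry_group Q\<^esub> carrier (orthogonal_group Q)
      \<subseteq> carrier (isometry_group Q)"
    using normal_imp_subgroup[OF normal_translation[OF nd]] subgroup_orthogonal
    by (meson set_mult_closed subgroup.subset)
  show "carrier (isometry_group Q)
      \<subseteq> carrier translation_group <#>\<^bsub>isometry_group Q\<^esub> carrier (orthogonal_group Q)"
  proof
    fix f assume "f \<in> carrier (isometry_group Q)"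
    then obtain h where "h \<in> carrier (orthogonal_group Q)" "f = (+) (f 0) \<circ> h"
      using isometry_decomposition[OF nd] by blast
    then show "f \<in> carrier translation_group <#>\<^bsub>isometry_group Q\<^esub> carrier (orthogonal_group Q)"
      unfolding set_mult_def by (auto simp: translation_group_def isometry_group_def)
  qed
qed

lemma linear_reflection: "linear (reflection Q u)"
  by (rule linearI) (auto simp: reflection_def polar_simps algebra_simps add_divide_distrib)

lemma reflection_involution: "Q u \<noteq> 0 \<Longrightarrow> reflection Q u (reflection Q u x) = x"
  by (simp add: reflection_def polar_simps polar_self algebra_simps)

lemma reflection_orthogonal:
  assumes "Q u \<noteq> 0"
  shows "reflection Q u \<in> carrier (orthogonal_group Q)"
proof -
  have "Q (reflection Q u x) = Q x" for x
    using assms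
    by (simp add: reflection_def quadratic_form_diff polar_simps quadratic_form_scaleR power2_eq_square)
  moreover have "bij (reflection Q u)"
    using reflection_involution[OF assms] by (intro o_bij[of "reflection Q u"]) auto
  ultimately show ?thesis
    by (simp add: orthogonal_group_def linear_reflection)
qed

text \<open>The reflections are the non-identity elements of the orthogonal group that fix a hyperplane
  \<open>{x. polar Q x u = 0}\<close> pointwise; the orthogonal vector \<open>u\<close> is then never null.\<close>
lemma reflection_iff:
  assumes nd: "nondegenerate Q"
  shows "h \<in> carrier (orthogonal_group Q) \<and> h \<noteq> id \<and> u \<noteq> 0 \<and> (\<forall>x. polar Q x u = 0 \<longrightarrow> h x = x)
         \<longleftrightarrow> Q u \<noteq> 0 \<and> h = reflection Q u"
proof (intro iffI; elim conjE)
  assume h: "h \<in> carrier (orthogonal_group Q)" and nid: "h \<noteq> id" and u: "u \<noteq> 0"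
    and fixed: "\<forall>x. polar Q x u = 0 \<longrightarrow> h x = x"
  have hq: "Q (h x) = Q x" for x using h by (simp add: orthogonal_group_def)
  obtain w0 where w0: "polar Q w0 u \<noteq> 0"
    using nd u unfolding nondegenerate_def by (metis polar_commute)
  have *: "\<exists>c. h w = w + c *\<^sub>R u" for w
  proof -
    define z where "z = h w - w"
    have z: "polar Q z x = 0" if "polar Q x u = 0" for x
      using orthogonal_polar[OF h, of w x] fixed that by (simp add: z_def polar_simps)
    define c where "c = polar Q z w0 / polar Q w0 u"
    have "polar Q (z - c *\<^sub>R u) x = 0" for x
      using z[of "x - (polar Q x u / polar Q w0 u) *\<^sub>R w0"] w0
      by (simp add: polar_simps c_def polar_commute[of u] field_simps)
    then have "z - c *\<^sub>R u = 0" using nd unfolding nondegenerate_def by blast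
    then show ?thesis by (intro exI[of _ c]) (simp add: z_def algebra_simps)
  qed
  then obtain c where c: "\<And>w. h w = w + c w *\<^sub>R u" by metis
  have eq: "c w * (2 * polar Q w u + c w * Q u) = 0" for w
    using hq[of w] by (simp add: c quadratic_form_add quadratic_form_scaleR polar_simps
        power2_eq_square algebra_simps)
  have nonfix: "c w = 0" if "polar Q w u = 0" for w
    using fixed that c[of w] u by simp
  have Qu: "Q u \<noteq> 0"
  proof
    assume "Q u = 0"
    then have "c w = 0" for w using eq[of w] nonfix[of w] by auto
    then have "h = id" by (auto simp: c)
    with nid show False by simp
  qed
  have lin: "linear h" using h by (simp add: orthogonal_group_def)
  obtain d where d: "h u = d *\<^sub>R u" using c[of u] by (metis scaleR_left_distrib scaleR_one)
  have hx: "h x = x + ((d - 1) * polar Q x u / Q u) *\<^sub>R u" for x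
  proof -
    define a where "a = polar Q x u / Q u"
    have "polar Q (x - a *\<^sub>R u) u = 0" using Qu by (simp add: a_def polar_simps polar_self)
    then have "h (x - a *\<^sub>R u) = x - a *\<^sub>R u" using fixed by blast
    then have "h x = x - a *\<^sub>R u + (a * d) *\<^sub>R u"
      by (simp add: linear_diff[OF lin] linear_cmul[OF lin] d algebra_simps)
    then show ?thesis by (simp add: a_def algebra_simps add_divide_distrib diff_divide_distrib)
  qed
  have "d\<^sup>2 = 1" using hq[of u] Qu by (simp add: d quadratic_form_scaleR)
  then have "d = 1 \<or> d = -1" by (simp add: power2_eq_1_iff)
  moreover have "d \<noteq> 1" using hx nid by auto
  ultimately have "h = reflection Q u" by (auto simp: hx reflection_def)
  with Qu show "Q u \<noteq> 0 \<and> h = reflection Q u" by simp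
next
  assume u: "Q u \<noteq> 0" and h: "h = reflection Q u"
  then have u0: "u \<noteq> 0" using quadratic_form_0 by auto
  have "reflection Q u u = - u" using u by (simp add: reflection_def polar_self scaleR_2)
  moreover have "u \<noteq> - u"
    using u0 scaleR_2[of u] by (metis add.right_inverse scaleR_eq_0_iff zero_neq_numeral)
  ultimately have "h \<noteq> id" using h by auto
  then show "h \<in> carrier (orthogonal_group Q) \<and> h \<noteq> id \<and> u \<noteq> 0 \<and> (\<forall>x. polar Q x u = 0 \<longrightarrow> h x = x)"
    using u0 reflection_orthogonal[OF u] by (simp add: h reflection_def)
qed

lemma reflection_diff:
  assumes "Q x = Q y" "Q (x - y) \<noteq> 0"
  shows "reflection Q (x - y) x = y"
proof -
  have "2 * polar Q x (x - y) = Q (x - y)"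
    using assms(1) by (simp add: polar_simps polar_self quadratic_form_diff)
  then show ?thesis using assms(2) by (simp add: reflection_def)
qed

text \<open>Every element of the orthogonal group is a product of reflections.\<close>
lemma orthogonal_eq_prod_reflections:
  assumes nd: "nondegenerate Q" and sig: "has_signature Q p q"
    and h: "h \<in> carrier (orthogonal_group Q)"
  shows "\<exists>us. (\<forall>u\<in>set us. Q u \<noteq> 0) \<and> h = foldr (\<circ>) (map (reflection Q) us) id"
proof -
  interpret group "isometry_group Q" by (rule group_isometry_group)
  have comp: "f \<circ> g \<in> carrier (orthogonal_group Q)"
    if "f \<in> carrier (orthogonal_group Q)" "g \<in> carrier (orthogonal_group Q)" for f g
    using subgroup.m_closed[OF subgroup_orthogonal that] by (simp add: isometry_group_def)
  obtain B where B: "finite B" "independent B" "span B = UNIV"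
    and orth: "pairwise (\<lambda>x y. polar Q x y = 0) B"
    using sig unfolding has_signature_def by blast
  have nonnull: "Q v \<noteq> 0" if v: "v \<in> B" for v
  proof
    assume "Q v = 0"
    then have "polar Q v x = 0" if "x \<in> B" for x
      using orth v that by (cases "x = v") (auto simp: pairwise_def polar_self)
    moreover have "linear (polar Q v)" using bilinear_polar by (simp add: bilinear_def)
    ultimately have "polar Q v x = 0" for x
      using linear_eq_0_on_span[of "polar Q v" B x] B(3) by auto
    then have "v = 0" using nd unfolding nondegenerate_def by blast
    then show False using v B(2) dependent_zero by blast
  qed
  have prod_Cons: "foldr (\<circ>) (map (reflection Q) (u # us)) id
      = reflection Q u \<circ> foldr (\<circ>) (map (reflection Q) us) id" for u us
    by simp
  have fix_refl: "reflection Q w x = x" if "polar Q x w = 0" for w x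
    using that by (simp add: reflection_def)
  have "\<exists>us. (\<forall>u\<in>set us. Q u \<noteq> 0) \<and> h = foldr (\<circ>) (map (reflection Q) us) id"
    if "finite F" "F \<subseteq> B" "h \<in> carrier (orthogonal_group Q)" "\<forall>x\<in>B - F. h x = x" for F h
    using that
  proof (induction F arbitrary: h rule: finite_induct)
    case empty
    then have "h x = id x" for x
      using linear_eq_on_span[of h id B x] B(3) linear_id by (auto simp: orthogonal_group_def)
    then show ?case by (intro exI[of _ "[]"]) auto
  next
    case (insert v F)
    then have v: "v \<in> B" and F: "F \<subseteq> B" and h: "h \<in> carrier (orthogonal_group Q)"
      and fixed: "\<And>x. x \<in> B \<Longrightarrow> x \<notin> F \<Longrightarrow> x \<noteq> v \<Longrightarrow> h x = x" by auto
    have hv: "Q (h v) = Q v" using h by (simp add: orthogonal_group_def)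
    have xv: "polar Q x v = 0" "polar Q x (h v) = 0" if x: "x \<in> B" "x \<notin> F" "x \<noteq> v" for x
    proof -
      show *: "polar Q x v = 0" using orth v x by (auto simp: pairwise_def)
      show "polar Q x (h v) = 0"
        using orthogonal_polar[OF h, of x v] fixed[OF x] * by simp
    qed
    show ?case
    proof (cases "Q (h v - v) = 0")
      case False
      let ?w = "h v - v"
      let ?g = "reflection Q ?w \<circ> h"
      have "?g x = x" if "x \<in> B - F" for x
        using that fixed[of x] xv[of x] reflection_diff[OF hv False]
        by (cases "x = v") (auto simp: fix_refl polar_simps)
      then obtain us where "\<forall>u\<in>set us. Q u \<noteq> 0" "?g = foldr (\<circ>) (map (reflection Q) us) id"
        using insert.IH[OF F, of ?g] comp[OF reflection_orthogonal[OF False] h] by blast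
      moreover have "h = reflection Q ?w \<circ> ?g"
        by (auto simp: reflection_involution[OF False])
      ultimately show ?thesis
        using False by (intro exI[of _ "?w # us"] conjI) (simp, simp only: prod_Cons)
    next
      case True
      let ?w = "h v - - v"
      let ?g = "reflection Q v \<circ> (reflection Q ?w \<circ> h)"
      have nv: "Q v \<noteq> 0" by (rule nonnull[OF v])
      have w: "Q ?w \<noteq> 0"
        using True nv hv quadratic_form_add[of "h v" v] quadratic_form_diff[of "h v" v] by simp
      have "reflection Q v (- v) = v"
        using nv by (simp add: reflection_def polar_simps polar_self scaleR_2)
      then have "?g x = x" if "x \<in> B - F" for x
        using that fixed[of x] xv[of x] reflection_diff[OF _ w] hv
        by (cases "x = v") (auto simp: fix_refl polar_simps quadratic_form_minus)
      then obtain us where "\<forall>u\<in>set us. Q u \<noteq> 0" "?g = foldr (\<circ>) (map (reflection Q) us) id"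
        using insert.IH[OF F, of ?g]
          comp[OF reflection_orthogonal[OF nv] comp[OF reflection_orthogonal[OF w] h]] by blast
      moreover have "h = reflection Q ?w \<circ> (reflection Q v \<circ> ?g)"
        using reflection_involution[OF w] reflection_involution[OF nv] by (auto simp: fun_eq_iff)
      ultimately show ?thesis
        using w nv by (intro exI[of _ "?w # v # us"] conjI) (simp, simp only: prod_Cons)
    qed
  qed
  from this[OF B(1) subset_refl h] show ?thesis by simp
qed

end

end

theory Submission
  imports Defs "Jordan_Normal_Form.Determinant"
begin

text \<open>Let \<open>P\<close> be a maximal positive definite subspace and, for \<open>h\<close> orthogonal, let \<open>\<epsilon>(h)\<close> be the sign of
  the determinant of the orthogonal projection of \<open>h|P\<close> to \<open>P\<close>. Replacing \<open>h\<close> by \<open>r\<^sub>u \<circ> h\<close> is a rank-one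
  update, which multiplies this determinant by \<open>(Q u - 2 (u, w)) / Q u\<close>, where \<open>w \<in> h(P)\<close> has the same
  projection to \<open>P\<close> as \<open>u\<close>. Since \<open>2 (u, w) - Q u = Q w - Q (u - w) > 0\<close>, a reflection changes
  \<open>\<epsilon>\<close> exactly when \<open>Q u > 0\<close>. Hence \<open>h\<close> determines the parity of the number of positive supporting
  vectors, and, on replacing \<open>Q\<close> by \<open>-Q\<close>, of the negative ones. The linear part of a product
  of squares has both parities even.

  Conversely, if \<open>Q u\<close> and \<open>Q v\<close> have the same sign, then \<open>r\<^sub>u \<circ> r\<^sub>v\<close> is a square: after rescaling to
  \<open>Q u = Q v\<close>, one of \<open>u - v\<close>, \<open>u + v\<close> is not null and its reflection conjugates \<open>r\<^sub>u\<close> to \<open>r\<^sub>v\<close>. By conjugation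
  the factors of an even product can be rearranged into such pairs.\<close>

section \<open>A determinant identity\<close>

text \<open>Sylvester's determinant identity. Multiplying the block matrix with rows
  \<open>(1, X)\<close> and \<open>(Y, 1)\<close> by the unipotent \<open>?L\<close> on the right or
  on the left clears the lower left block, leaving \<open>1 - X * Y\<close> or
  \<open>1 - Y * X\<close> on the diagonal; since \<open>det ?L = 1\<close>, both determinants equal
  \<open>det ?N\<close>.\<close>

lemma det_one_minus_mult_commute:
  fixes X Y :: "'a::idom mat"
  assumes X: "X \<in> carrier_mat n m" and Y: "Y \<in> carrier_mat m n"
  shows "det (1\<^sub>m n - X * Y) = det (1\<^sub>m m - Y * X)"
proof -
  let ?N = "four_block_mat (1\<^sub>m n) X Y (1\<^sub>m m)"
  let ?L = "four_block_mat (1\<^sub>m n) (0\<^sub>m n m) (- Y) (1\<^sub>m m)"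
  have N: "?N \<in> carrier_mat (n + m) (n + m)" and L: "?L \<in> carrier_mat (n + m) (n + m)"
    using X Y by auto
  have XY: "X * Y \<in> carrier_mat n n" and YX: "Y * X \<in> carrier_mat m m"
    using X Y by auto
  have det_L: "det ?L = 1"
    using Y by (subst det_four_block_mat_upper_right_zero) auto
  have blocks: "1\<^sub>m n + X * - Y = 1\<^sub>m n - X * Y" "- Y * X + 1\<^sub>m m = 1\<^sub>m m - Y * X"
    "Y + - Y = 0\<^sub>m m n" "- Y + Y = 0\<^sub>m m n"
    using X Y by (auto intro!: eq_matI)
  have "?N * ?L = four_block_mat (1\<^sub>m n - X * Y) X (0\<^sub>m m n) (1\<^sub>m m)"
    using X Y by (subst mult_four_block_mat[of _ n n _ m _ m _ _ n _ m]) (auto simp: blocks)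
  then have "det (?N * ?L) = det (1\<^sub>m n - X * Y)"
    using X XY by (simp add: det_four_block_mat_lower_left_zero[of _ n _ m] minus_carrier_mat[OF XY])
  moreover have "?L * ?N = four_block_mat (1\<^sub>m n) X (0\<^sub>m m n) (1\<^sub>m m - Y * X)"
    using X Y by (subst mult_four_block_mat[of _ n n _ m _ m _ _ n _ m]) (auto simp: blocks)
  then have "det (?L * ?N) = det (1\<^sub>m m - Y * X)"
    using X YX by (simp add: det_four_block_mat_lower_left_zero[of _ n _ m] minus_carrier_mat[OF YX])
  ultimately show ?thesis
    using det_L by (simp add: det_mult[OF N L] det_mult[OF L N])
qed

section \<open>The sign of a reflection on a maximal positive definite subspace\<close>

definition prod_reflections :: "('v::real_vector \<Rightarrow> real) \<Rightarrow> 'v list \<Rightarrow> 'v \<Rightarrow> 'v" where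
  "prod_reflections Q us = foldr (\<circ>) (map (reflection Q) us) id"

lemma prod_reflections_Nil: "prod_reflections Q [] = id"
  unfolding prod_reflections_def by simp

lemma prod_reflections_Cons: "prod_reflections Q (u # us) = reflection Q u \<circ> prod_reflections Q us"
  unfolding prod_reflections_def by simp

text \<open>An orthogonal, not normalised, basis of the subspace \<open>P\<close>. Maximality is
  encoded as negative definiteness of the orthogonal complement, which is the form in which it gets
  applied.\<close>

definition maximal_positive_frame :: "('v::real_vector \<Rightarrow> real) \<Rightarrow> nat \<Rightarrow> (nat \<Rightarrow> 'v) \<Rightarrow> bool" where
  "maximal_positive_frame Q p e \<longleftrightarrow>
     (\<forall>i<p. Q (e i) > 0) \<and> (\<forall>i<p. \<forall>j<p. i \<noteq> j \<longrightarrow> polar Q (e i) (e j) = 0) \<and>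
     (\<forall>x. x \<noteq> 0 \<and> (\<forall>i<p. polar Q (e i) x = 0) \<longrightarrow> Q x < 0)"

text \<open>Up to multiplying row \<open>i\<close> by \<open>Q (e i) > 0\<close>, this is the matrix
  of \<open>h\<close> restricted to \<open>P\<close> and projected back to \<open>P\<close>, so its
  determinant has the sign \<epsilon>(h).\<close>

definition frame_mat ::
  "('v::real_vector \<Rightarrow> real) \<Rightarrow> nat \<Rightarrow> (nat \<Rightarrow> 'v) \<Rightarrow> ('v \<Rightarrow> 'v) \<Rightarrow> real mat" where
  "frame_mat Q p e h = mat p p (\<lambda>(i, j). polar Q (e i) (h (e j)))"

context
  fixes Q :: "'v::real_vector \<Rightarrow> real"
  assumes Q: "quadratic_form Q"
begin

section \<open>Orthogonal families and existence of a frame\<close>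

lemma polar_sum_left: "polar Q (\<Sum>i\<in>I. c i *\<^sub>R f i) x = (\<Sum>i\<in>I. c i * polar Q (f i) x)"
proof -
  have "linear (\<lambda>y. polar Q y x)"
    using bilinear_polar[OF Q] by (simp add: bilinear_def)
  from linear_sum[OF this, of "\<lambda>i. c i *\<^sub>R f i" I] show ?thesis
    by (simp add: polar_simps[OF Q])
qed

lemma polar_sum_right: "polar Q x (\<Sum>i\<in>I. c i *\<^sub>R f i) = (\<Sum>i\<in>I. c i * polar Q x (f i))"
  using polar_sum_left[of c f I x] by (simp add: polar_commute[OF Q])

lemma quadratic_form_sum_orthogonal:
  assumes "finite I" and orth: "\<And>i j. i \<in> I \<Longrightarrow> j \<in> I \<Longrightarrow> i \<noteq> j \<Longrightarrow> polar Q (f i) (f j) = 0"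
  shows "Q (\<Sum>i\<in>I. c i *\<^sub>R f i) = (\<Sum>i\<in>I. (c i)\<^sup>2 * Q (f i))"
proof -
  have "(\<Sum>j\<in>I. c j * polar Q (f i) (f j)) = c i * Q (f i)" if i: "i \<in> I" for i
  proof -
    have "(\<Sum>j\<in>I. c j * polar Q (f i) (f j)) = (\<Sum>j\<in>I. if j = i then c i * Q (f i) else 0)"
      using orth i by (intro sum.cong) (auto simp: polar_self[OF Q])
    then show ?thesis using i assms(1) by simp
  qed
  then have "(\<Sum>i\<in>I. c i * (\<Sum>j\<in>I. c j * polar Q (f i) (f j))) = (\<Sum>i\<in>I. (c i)\<^sup>2 * Q (f i))"
    by (intro sum.cong) (auto simp: power2_eq_square mult.assoc)
  then have "polar Q (\<Sum>i\<in>I. c i *\<^sub>R f i) (\<Sum>i\<in>I. c i *\<^sub>R f i) = (\<Sum>i\<in>I. (c i)\<^sup>2 * Q (f i))"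
    by (simp only: polar_sum_left) (simp only: polar_sum_right)
  then show ?thesis
    by (simp only: polar_self[OF Q])
qed

text \<open>The frame enumerates the positive vectors of an orthogonal basis. Non-degeneracy
  excludes null basis vectors, so a vector orthogonal to the frame is a combination of negative
  ones.\<close>

lemma maximal_positive_frame_exists:
  assumes nd: "nondegenerate Q" and sig: "has_signature Q p q"
  shows "\<exists>e. maximal_positive_frame Q p e"
proof -
  obtain B where B: "finite B" "span B = UNIV" "independent B"
    and orth: "\<And>x y. x \<in> B \<Longrightarrow> y \<in> B \<Longrightarrow> x \<noteq> y \<Longrightarrow> polar Q x y = 0"
    and p: "card {x \<in> B. Q x > 0} = p"
    using sig unfolding has_signature_def pairwise_def by blast
  obtain e where "bij_betw e {0..<p} {x \<in> B. Q x > 0}"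
    using B(1) p ex_bij_betw_nat_finite[of "{x \<in> B. Q x > 0}"] by auto
  then have img: "e ` {0..<p} = {x \<in> B. Q x > 0}" and inj: "inj_on e {0..<p}"
    by (auto simp: bij_betw_def)
  have eB: "e i \<in> B" "Q (e i) > 0" if "i < p" for i
  proof -
    have "e i \<in> e ` {0..<p}" using that by simp
    then show "e i \<in> B" "Q (e i) > 0" unfolding img by auto
  qed
  have expand: "\<exists>c. x = (\<Sum>b\<in>B. c b *\<^sub>R b)" for x
  proof -
    have "x \<in> span B" using B(2) by simp
    then show ?thesis unfolding span_finite[OF B(1)] by auto
  qed
  have coord: "polar Q b (\<Sum>b\<in>B. c b *\<^sub>R b) = c b * Q b" if b: "b \<in> B" for b c
  proof -
    have "polar Q b (\<Sum>b\<in>B. c b *\<^sub>R b) = (\<Sum>d\<in>B. if d = b then c b * Q b else 0)"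
      unfolding polar_sum_right using orth b by (intro sum.cong) (auto simp: polar_self[OF Q])
    then show ?thesis using b B(1) by simp
  qed
  \<comment> \<open>A null member of an orthogonal basis would be orthogonal to every
    vector.\<close>
  have nonnull: "Q b \<noteq> 0" if b: "b \<in> B" for b
  proof
    assume "Q b = 0"
    then have "polar Q b x = 0" for x
      using expand[of x] coord[OF b] by auto
    then have "b = 0" using nd unfolding nondegenerate_def by blast
    then show False using b B(3) dependent_zero by blast
  qed
  have "Q x < 0" if x0: "x \<noteq> 0" and perp: "\<And>i. i < p \<Longrightarrow> polar Q (e i) x = 0" for x
  proof -
    obtain c where c: "x = (\<Sum>b\<in>B. c b *\<^sub>R b)" using expand by blast
    \<comment> \<open>Pairing \<open>x\<close> with a positive basis vector isolates its coordinate,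
      which therefore vanishes.\<close>
    have pos: "c b = 0" if b: "b \<in> B" "Q b > 0" for b
    proof -
      obtain i where "i < p" "b = e i"
        using b img by (metis (mono_tags, lifting) atLeastLessThan_iff imageE mem_Collect_eq)
      then show ?thesis using perp[of i] coord[OF b(1), of c] b by (simp add: c)
    qed
    obtain b where b: "b \<in> B" "c b \<noteq> 0"
      using x0 c by (metis (no_types, lifting) scale_zero_left sum.neutral)
    have Qx: "- Q x = (\<Sum>b\<in>B. - ((c b)\<^sup>2 * Q b))"
      unfolding c by (subst quadratic_form_sum_orthogonal[OF B(1), of id, simplified])
        (auto simp: orth sum_negf)
    have neg: "Q d < 0 \<or> c d = 0" if "d \<in> B" for d
      using pos[OF that] nonnull[OF that] by linarith
    have "(\<Sum>b\<in>B. - ((c b)\<^sup>2 * Q b)) > 0"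
    proof (rule sum_pos2[OF B(1) b(1)])
      show "0 < - ((c b)\<^sup>2 * Q b)"
        using neg[OF b(1)] b(2) by (simp add: mult_pos_neg)
      show "0 \<le> - ((c d)\<^sup>2 * Q d)" if "d \<in> B" for d
        using neg[OF that] by (auto simp: mult_nonneg_nonpos)
    qed
    then show ?thesis using Qx by simp
  qed
  moreover have "polar Q (e i) (e j) = 0" if "i < p" "j < p" "i \<noteq> j" for i j
    using that eB orth inj by (simp add: inj_on_eq_iff)
  ultimately show ?thesis
    using eB unfolding maximal_positive_frame_def by (intro exI[of _ e]) auto
qed

section \<open>The determinant sign on a fixed frame\<close>

context
  fixes p :: nat and e :: "nat \<Rightarrow> 'v"
  assumes frame: "maximal_positive_frame Q p e"
begin

lemma quadratic_form_perp_frame: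
  "(\<And>i. i < p \<Longrightarrow> polar Q (e i) x = 0) \<Longrightarrow> x = 0 \<or> Q x < 0"
  using frame by (auto simp: maximal_positive_frame_def)

lemma quadratic_form_frame:
  "Q (\<Sum>j\<in>{0..<p}. c j *\<^sub>R e j) = (\<Sum>j\<in>{0..<p}. (c j)\<^sup>2 * Q (e j))"
  using frame by (intro quadratic_form_sum_orthogonal) (auto simp: maximal_positive_frame_def)

lemma quadratic_form_frame_nonneg: "Q (\<Sum>j\<in>{0..<p}. c j *\<^sub>R e j) \<ge> 0"
  unfolding quadratic_form_frame
  using frame by (intro sum_nonneg) (auto simp: maximal_positive_frame_def less_imp_le)

lemma quadratic_form_frame_pos:
  assumes "k < p" "c k \<noteq> 0"
  shows "Q (\<Sum>j\<in>{0..<p}. c j *\<^sub>R e j) > 0"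
  unfolding quadratic_form_frame using assms frame
  by (intro sum_pos2[of _ k]) (auto simp: maximal_positive_frame_def less_imp_le)

lemma orthogonal_frame_sum:
  assumes "h \<in> carrier (orthogonal_group Q)"
  shows "h (\<Sum>j\<in>{0..<p}. c j *\<^sub>R e j) = (\<Sum>j\<in>{0..<p}. c j *\<^sub>R h (e j))"
  using assms by (simp add: orthogonal_group_def linear_sum linear_cmul)

text \<open>A kernel vector would give a nonzero \<open>w\<close> in \<open>P\<close> with
  \<open>h w\<close> orthogonal to \<open>P\<close>. Then \<open>h w\<close> is zero or negative,
  whereas \<open>Q (h w) = Q w > 0\<close>.\<close>

lemma det_frame_mat_nonzero:
  assumes h: "h \<in> carrier (orthogonal_group Q)"
  shows "det (frame_mat Q p e h) \<noteq> 0"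
proof
  have A: "frame_mat Q p e h \<in> carrier_mat p p" by (simp add: frame_mat_def)
  assume "det (frame_mat Q p e h) = 0"
  then obtain v where v: "v \<in> carrier_vec p" "v \<noteq> 0\<^sub>v p" "frame_mat Q p e h *\<^sub>v v = 0\<^sub>v p"
    using det_0_iff_vec_prod_zero[OF A] by blast
  define c where "c = vec_index v"
  define w where "w = (\<Sum>j\<in>{0..<p}. c j *\<^sub>R e j)"
  obtain k where k: "k < p" "c k \<noteq> 0"
    using v(1,2) unfolding c_def by (metis eq_vecI carrier_vecD index_zero_vec(1,2))
  have pos: "Q (h w) > 0"
    using quadratic_form_frame_pos[of k c] k h by (simp add: orthogonal_group_def w_def)
  have "polar Q (e i) (h w) = 0" if "i < p" for i
  proof -
    have "polar Q (e i) (h w) = vec_index (frame_mat Q p e h *\<^sub>v v) i"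
      using that v(1) by (simp add: w_def orthogonal_frame_sum[OF h] polar_sum_right frame_mat_def
          scalar_prod_def c_def mult.commute)
    then show ?thesis using v(3) that by simp
  qed
  from quadratic_form_perp_frame[OF this] pos show False
    using quadratic_form_0[OF Q] by auto
qed

text \<open>The matrix changes by the rank-one term \<open>a * b\<close>, so the determinant is
  multiplied by the scalar \<open>1 - b * x\<close> with \<open>A * x = a\<close>. This scalar is
  then computed from a vector \<open>w\<close> of \<open>h(P)\<close>, and definiteness on
  \<open>P\<close> and on its complement fixes its sign.\<close>

lemma sgn_det_frame_mat_reflection:
  assumes h: "h \<in> carrier (orthogonal_group Q)" and u: "Q u \<noteq> 0"
  shows "sgn (det (frame_mat Q p e (reflection Q u \<circ> h))) = - sgn (Q u) * sgn (det (frame_mat Q p e h))"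
proof -
  define A where "A = frame_mat Q p e h"
  have A: "A \<in> carrier_mat p p" by (simp add: A_def frame_mat_def)
  \<comment> \<open>The reflection subtracts \<open>b $$ (0, j)\<close> times \<open>u\<close> from
    \<open>h (e j)\<close>; the column \<open>a\<close> pairs \<open>u\<close> with the frame. The
    adjugate expresses the solution \<open>x\<close> of \<open>A * x = a\<close>.\<close>
  define a where "a = mat p 1 (\<lambda>(i, _). polar Q (e i) u)"
  define b where "b = mat 1 p (\<lambda>(_, j). 2 * polar Q (h (e j)) u / Q u)"
  define x where "x = (1 / det A) \<cdot>\<^sub>m (adj_mat A * a)"
  have a: "a \<in> carrier_mat p 1" and b: "b \<in> carrier_mat 1 p"
    by (auto simp: a_def b_def)
  have adj: "adj_mat A \<in> carrier_mat p p" "A * adj_mat A = det A \<cdot>\<^sub>m 1\<^sub>m p"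
    using adj_mat[OF A] by auto
  have x: "x \<in> carrier_mat p 1" using adj a by (auto simp: x_def)
  have det0: "det A \<noteq> 0" using det_frame_mat_nonzero[OF h] by (simp add: A_def)
  have "A * (adj_mat A * a) = det A \<cdot>\<^sub>m a"
    using assoc_mult_mat[OF A adj(1) a] adj(2) a by (simp add: mult_smult_assoc_mat[of _ p p _ 1])
  then have Ax: "A * x = a"
    using adj(1) a det0 A by (auto simp: x_def mult_smult_distrib[of _ p p _ 1] intro!: eq_matI)
  have upd: "frame_mat Q p e (reflection Q u \<circ> h) = A - a * b"
    by (rule eq_matI)
      (auto simp: frame_mat_def A_def a_def b_def reflection_def polar_simps[OF Q] scalar_prod_def)
  also have "\<dots> = A * (1\<^sub>m p - x * b)"
  proof -
    have "A * (1\<^sub>m p - x * b) = A * 1\<^sub>m p - A * (x * b)"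
      using A x b by (intro mult_minus_distrib_mat[of _ p p _ p]) auto
    then show ?thesis
      using Ax assoc_mult_mat[OF A x b] A by simp
  qed
  finally have "det (frame_mat Q p e (reflection Q u \<circ> h)) = det A * det (1\<^sub>m p - x * b)"
    using A x b by (simp add: det_mult[of _ p] minus_carrier_mat)
  also have "det (1\<^sub>m p - x * b) = det (1\<^sub>m 1 - b * x)"
    by (rule det_one_minus_mult_commute[OF x b])
  also have "\<dots> = 1 - (b * x) $$ (0, 0)"
    using b x by (subst det_single) auto
  finally have det_eq:
    "det (frame_mat Q p e (reflection Q u \<circ> h)) = det A * (1 - (b * x) $$ (0, 0))" .
  \<comment> \<open>Reading \<open>x\<close> as coordinates on the frame, \<open>A * x = a\<close>
    says that \<open>w = h v\<close> and \<open>u\<close> have the same projection to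
    \<open>P\<close>.\<close>
  define c where "c j = x $$ (j, 0)" for j
  define v where "v = (\<Sum>j\<in>{0..<p}. c j *\<^sub>R e j)"
  define w where "w = h v"
  have w: "w = (\<Sum>j\<in>{0..<p}. c j *\<^sub>R h (e j))"
    by (simp add: w_def v_def orthogonal_frame_sum[OF h])
  have bx: "(b * x) $$ (0, 0) = 2 * polar Q w u / Q u"
    using x by (simp add: b_def c_def w polar_sum_left scalar_prod_def sum_distrib_left
        sum_divide_distrib mult_ac)
  have "polar Q (e i) (u - w) = 0" if i: "i < p" for i
  proof -
    have "(A * x) $$ (i, 0) = polar Q (e i) w"
      using i x by (simp add: A_def frame_mat_def w c_def polar_sum_right scalar_prod_def mult_ac)
    then show ?thesis using Ax i by (simp add: a_def polar_simps[OF Q])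
  qed
  then have perp: "u - w = 0 \<or> Q (u - w) < 0"
    by (rule quadratic_form_perp_frame)
  have w_nonneg: "Q w \<ge> 0"
    using quadratic_form_frame_nonneg[of c] h by (simp add: w_def v_def orthogonal_group_def)
  \<comment> \<open>The first term is nonnegative and \<open>Q (u - w)\<close> is negative unless
    \<open>u = w\<close>; in that case \<open>Q w = Q u\<close> is nonzero.\<close>
  have "Q w - Q (u - w) > 0"
    using perp
  proof
    assume "u - w = 0"
    then show ?thesis using w_nonneg u by (simp add: quadratic_form_0[OF Q])
  qed (use w_nonneg in linarith)
  then have "2 * polar Q w u - Q u > 0"
    using quadratic_form_diff[OF Q, of u w] by (simp add: polar_commute[OF Q, of w u])
  then have "sgn (1 - 2 * polar Q w u / Q u) = - sgn (Q u)"
    using u by (auto simp: sgn_if field_simps)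
  then show ?thesis
    by (simp add: det_eq bx sgn_mult A_def)
qed

end

section \<open>Parity of the number of positive supporting vectors\<close>

lemma orthogonal_comp:
  assumes "f \<in> carrier (orthogonal_group Q)" "g \<in> carrier (orthogonal_group Q)"
  shows "f \<circ> g \<in> carrier (orthogonal_group Q)"
  using subgroup.m_closed[OF subgroup_orthogonal[OF Q] assms] by (simp add: isometry_group_def)

lemma prod_reflections_orthogonal:
  assumes "\<forall>u\<in>set us. Q u \<noteq> 0"
  shows "prod_reflections Q us \<in> carrier (orthogonal_group Q)"
  using assms
proof (induction us)
  case Nil
  then show ?case using linear_id by (simp add: orthogonal_group_def prod_reflections_Nil id_def[symmetric])
next
  case (Cons u us)
  then show ?case
    unfolding prod_reflections_Cons by (intro orthogonal_comp reflection_orthogonal[OF Q]) auto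
qed

text \<open>The determinant sign depends on the product only as a map, while each positive factor
  flips it and each negative factor keeps it. Starting from the nonzero sign \<open>s\<close> of
  \<open>id\<close>, it thus records the parity of the positive factors.\<close>

lemma even_positive_reflections_unique:
  assumes nd: "nondegenerate Q" and sig: "has_signature Q p q"
    and us: "\<forall>u\<in>set us. Q u \<noteq> 0" and vs: "\<forall>v\<in>set vs. Q v \<noteq> 0"
    and eq: "prod_reflections Q us = prod_reflections Q vs"
  shows "even (length (filter (\<lambda>u. Q u > 0) us)) \<longleftrightarrow> even (length (filter (\<lambda>v. Q v > 0) vs))"
proof -
  obtain e where e: "maximal_positive_frame Q p e"
    using maximal_positive_frame_exists[OF nd sig] by blast
  define s where "s = sgn (det (frame_mat Q p e id))"
  have s: "s \<noteq> 0"
    using det_frame_mat_nonzero[OF e, of id] linear_id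
    by (simp add: s_def sgn_zero_iff orthogonal_group_def)
  have sgn_prod: "sgn (det (frame_mat Q p e (prod_reflections Q ws)))
      = (-1) ^ length (filter (\<lambda>u. Q u > 0) ws) * s" if "\<forall>w\<in>set ws. Q w \<noteq> 0" for ws
    using that
  proof (induction ws)
    case (Cons w ws)
    then have "sgn (det (frame_mat Q p e (prod_reflections Q (w # ws))))
        = - sgn (Q w) * ((-1) ^ length (filter (\<lambda>u. Q u > 0) ws) * s)"
      using sgn_det_frame_mat_reflection[OF e prod_reflections_orthogonal, of ws w]
      by (simp add: prod_reflections_Cons)
    then show ?case using Cons.prems by (auto simp: sgn_if)
  qed (simp add: s_def prod_reflections_Nil)
  have "(-1 :: real) ^ length (filter (\<lambda>u. Q u > 0) us) = (-1) ^ length (filter (\<lambda>v. Q v > 0) vs)"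
    using sgn_prod[OF us] sgn_prod[OF vs] s by (simp add: eq)
  then show ?thesis
    by (cases "even (length (filter (\<lambda>u. Q u > 0) us))";
        cases "even (length (filter (\<lambda>v. Q v > 0) vs))") auto
qed

end

section \<open>Negating the form\<close>

lemma polar_uminus_form: "polar (\<lambda>x. - Q x) x y = - polar Q x y"
  by (simp add: polar_def field_simps)

lemma quadratic_form_uminus_form:
  assumes "quadratic_form Q"
  shows "quadratic_form (\<lambda>x. - Q x)"
proof -
  have "bilinear (\<lambda>x y. - polar Q x y)"
    using bilinear_polar[OF assms] by (auto simp: bilinear_def intro: linear_compose_neg)
  moreover have "polar (\<lambda>x. - Q x) = (\<lambda>x y. - polar Q x y)"
    by (intro ext) (rule polar_uminus_form)
  ultimately show ?thesis
    using assms by (simp add: quadratic_form_def)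
qed

lemma nondegenerate_uminus_form: "nondegenerate (\<lambda>x. - Q x) \<longleftrightarrow> nondegenerate Q"
  by (simp add: nondegenerate_def polar_uminus_form)

lemma has_signature_uminus_form: "has_signature (\<lambda>x. - Q x) q p \<longleftrightarrow> has_signature Q p q"
  by (auto simp: has_signature_def polar_uminus_form)

lemma reflection_uminus_form: "reflection (\<lambda>x. - Q x) = reflection Q"
  by (intro ext) (simp add: reflection_def polar_uminus_form)

text \<open>\<open>Q\<close> and \<open>-Q\<close> have the same reflections, but positive and
  negative supporting vectors trade places and the signature becomes \<open>(q, p)\<close>.\<close>

lemma even_negative_reflections_unique:
  assumes quad: "quadratic_form Q" and nd: "nondegenerate Q" and sig: "has_signature Q p q"
    and us: "\<forall>u\<in>set us. Q u \<noteq> 0" and vs: "\<forall>v\<in>set vs. Q v \<noteq> 0"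
    and eq: "prod_reflections Q us = prod_reflections Q vs"
  shows "even (length (filter (\<lambda>u. Q u < 0) us)) \<longleftrightarrow> even (length (filter (\<lambda>v. Q v < 0) vs))"
  using even_positive_reflections_unique[OF quadratic_form_uminus_form[OF quad], of q p us vs]
    nd sig us vs eq
  by (simp add: nondegenerate_uminus_form has_signature_uminus_form prod_reflections_def
      reflection_uminus_form)

lemma length_eq_positive_plus_negative:
  assumes "\<forall>u\<in>set us. Q u \<noteq> (0::real)"
  shows "length us = length (filter (\<lambda>u. Q u > 0) us) + length (filter (\<lambda>u. Q u < 0) us)"
  using assms by (induction us) auto

section \<open>Products of squares\<close>

lemma foldr_comp_append: "foldr (\<circ>) (fs @ gs) id = foldr (\<circ>) fs id \<circ> foldr (\<circ>) gs id"
  by (induction fs) (auto simp: fun_eq_iff)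

lemma direct_isometry_mult:
  assumes "direct_isometry (isometry_group Q) f" "direct_isometry (isometry_group Q) g"
  shows "direct_isometry (isometry_group Q) (f \<circ> g)"
proof -
  obtain xs ys where xs: "set xs \<subseteq> carrier (isometry_group Q)" "f = foldr (\<circ>) (map (\<lambda>x. x \<circ> x) xs) id"
    and ys: "set ys \<subseteq> carrier (isometry_group Q)" "g = foldr (\<circ>) (map (\<lambda>x. x \<circ> x) ys) id"
    using assms by (auto simp: direct_isometry_def isometry_group_def)
  have "f \<circ> g = foldr (\<circ>) (map (\<lambda>x. x \<circ> x) (xs @ ys)) id"
    unfolding xs(2) ys(2) map_append foldr_comp_append ..
  then show ?thesis
    using xs ys unfolding direct_isometry_def
    by (intro exI[of _ "xs @ ys"]) (simp add: isometry_group_def)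
qed

lemma direct_isometry_id: "direct_isometry (isometry_group Q) id"
  unfolding direct_isometry_def by (intro exI[of _ "[]"]) (simp add: isometry_group_def)

lemma direct_isometry_square:
  "f \<in> carrier (isometry_group Q) \<Longrightarrow> direct_isometry (isometry_group Q) (f \<circ> f)"
  unfolding direct_isometry_def by (intro exI[of _ "[f]"]) (simp add: isometry_group_def)

lemma translation_in_isometry_group: "(+) t \<in> carrier (isometry_group Q)"
  by (simp add: isometry_group_def)

text \<open>A translation is the square of the translation by half its vector.\<close>

lemma direct_isometry_translation:
  fixes t :: "'v::real_vector"
  shows "direct_isometry (isometry_group Q) ((+) t)"
proof -
  have "(+) ((1/2) *\<^sub>R t) \<circ> (+) ((1/2) *\<^sub>R t) = (+) t"
    by (simp add: fun_eq_iff add.assoc[symmetric] scaleR_left_distrib[symmetric])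
  then show ?thesis
    using direct_isometry_square[OF translation_in_isometry_group[of "(1/2) *\<^sub>R t" Q]] by simp
qed

lemma prod_reflections_append:
  "prod_reflections Q (us @ vs) = prod_reflections Q us \<circ> prod_reflections Q vs"
  unfolding prod_reflections_def map_append foldr_comp_append ..

section \<open>Rearranging products of reflections into squares\<close>

context
  fixes Q :: "'v::real_vector \<Rightarrow> real"
  assumes Q: "quadratic_form Q"
begin

lemma orthogonal_comp_reflection:
  assumes g: "g \<in> carrier (orthogonal_group Q)"
  shows "g \<circ> reflection Q u = reflection Q (g u) \<circ> g"
proof
  fix x
  have "linear g" "Q (g u) = Q u" using g by (auto simp: orthogonal_group_def)
  then show "(g \<circ> reflection Q u) x = (reflection Q (g u) \<circ> g) x"
    by (simp add: reflection_def linear_diff linear_cmul orthogonal_polar[OF Q g])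
qed

text \<open>This moves \<open>g\<close> across a product at the price of replacing each supporting
  vector by its image, on which \<open>Q\<close> has the same value; hence sign counts
  survive.\<close>

lemma orthogonal_comp_prod_reflections:
  assumes g: "g \<in> carrier (orthogonal_group Q)"
  shows "g \<circ> prod_reflections Q us = prod_reflections Q (map g us) \<circ> g"
proof (induction us)
  case (Cons u us)
  have "g \<circ> prod_reflections Q (u # us) = (g \<circ> reflection Q u) \<circ> prod_reflections Q us"
    by (simp add: prod_reflections_Cons comp_assoc)
  also have "\<dots> = reflection Q (g u) \<circ> (g \<circ> prod_reflections Q us)"
    by (simp only: orthogonal_comp_reflection[OF g] comp_assoc)
  finally show ?case by (simp only: Cons list.map prod_reflections_Cons comp_assoc)
qed (simp add: prod_reflections_Nil)

lemma reflection_scaleR: "c \<noteq> 0 \<Longrightarrow> reflection Q (c *\<^sub>R u) = reflection Q u"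
  by (intro ext) (simp add: reflection_def polar_simps[OF Q] quadratic_form_scaleR[OF Q]
      power2_eq_square field_simps)

lemma orthogonal_in_isometry_group:
  "h \<in> carrier (orthogonal_group Q) \<Longrightarrow> h \<in> carrier (isometry_group Q)"
  using subgroup.subset[OF subgroup_orthogonal[OF Q]] by blast

lemma direct_isometry_reflection_pair:
  assumes uv: "Q u * Q v > 0"
  shows "direct_isometry (isometry_group Q) (reflection Q u \<circ> reflection Q v)"
proof -
  have *: "direct_isometry (isometry_group Q) (reflection Q u \<circ> reflection Q w)"
    if w: "Q u = Q w" "Q (u - w) \<noteq> 0" and u: "Q u \<noteq> 0" for w
  proof -
    let ?g = "reflection Q (u - w)"
    have g: "?g \<in> carrier (orthogonal_group Q)" by (rule reflection_orthogonal[OF Q w(2)])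
    have invol: "?g \<circ> ?g = id"
      by (rule ext) (simp add: reflection_involution[OF Q w(2)])
    \<comment> \<open>\<open>?g\<close> sends \<open>u\<close> to \<open>w\<close>, so it conjugates
      one reflection to the other. As \<open>?g\<close> is an involution, the product of the two
      reflections is the square of \<open>reflection Q u \<circ> ?g\<close>.\<close>
    have "?g \<circ> reflection Q u = reflection Q w \<circ> ?g"
      using orthogonal_comp_reflection[OF g, of u] reflection_diff[OF Q w] by simp
    then have "?g \<circ> reflection Q u \<circ> ?g = reflection Q w"
      using invol by (simp add: comp_assoc)
    then have "(reflection Q u \<circ> ?g) \<circ> (reflection Q u \<circ> ?g) = reflection Q u \<circ> reflection Q w"
      by (simp add: comp_assoc)
    moreover have "reflection Q u \<circ> ?g \<in> carrier (isometry_group Q)"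
      using orthogonal_in_isometry_group[OF g]
        orthogonal_in_isometry_group[OF reflection_orthogonal[OF Q u]]
      by (auto simp: isometry_group_def intro: bij_comp)
    ultimately show ?thesis using direct_isometry_square by metis
  qed
  have u: "Q u \<noteq> 0" and v: "Q v \<noteq> 0" using uv by auto
  \<comment> \<open>Rescaling \<open>v\<close> by \<open>c\<close> leaves its reflection unchanged
    and makes the two values of \<open>Q\<close> equal; the quotient is positive because the signs
    agree.\<close>
  define c where "c = sqrt (Q u / Q v)"
  have quot: "Q u / Q v > 0"
    using uv by (simp add: zero_less_divide_iff zero_less_mult_iff)
  then have c: "c \<noteq> 0" using u v by (simp add: c_def)
  have Qc: "Q (c *\<^sub>R v) = Q u"
    using quot v by (simp add: quadratic_form_scaleR[OF Q] c_def)
  show ?thesis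
  proof (cases "Q (u - c *\<^sub>R v) = 0")
    case False
    then show ?thesis using *[of "c *\<^sub>R v"] Qc u reflection_scaleR[OF c] by simp
  next
    case True
    \<comment> \<open>The parallelogram law gives
      \<open>Q (u + c v) + Q (u - c v) = 4 * Q u\<close>, so the two vectors cannot both be
      null.\<close>
    then have "Q (u - (- c) *\<^sub>R v) \<noteq> 0"
      using quadratic_form_add[OF Q, of u "c *\<^sub>R v"] quadratic_form_diff[OF Q, of u "c *\<^sub>R v"] Qc u
      by simp
    moreover have "Q ((- c) *\<^sub>R v) = Q u"
      using Qc by (simp add: quadratic_form_minus[OF Q])
    ultimately show ?thesis
      using *[of "(- c) *\<^sub>R v"] u reflection_scaleR[of "- c" v] c by simp
  qed
qed

text \<open>Induction on the length. The sign of the first vector occurs an even number of times,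
  hence again later; conjugation brings that later factor next to the first one. The pair is direct,
  and removing it keeps both parities.\<close>

lemma direct_isometry_prod_reflections:
  assumes "\<forall>u\<in>set us. Q u \<noteq> 0"
    and "even (length (filter (\<lambda>u. Q u > 0) us))" "even (length (filter (\<lambda>u. Q u < 0) us))"
  shows "direct_isometry (isometry_group Q) (prod_reflections Q us)"
  using assms
proof (induction "length us" arbitrary: us rule: less_induct)
  case less
  show ?case
  proof (cases us)
    case Nil
    then show ?thesis using direct_isometry_id by (simp add: prod_reflections_Nil)
  next
    case (Cons u ws)
    have u: "Q u \<noteq> 0" using less.prems Cons by simp
    have "\<exists>v\<in>set ws. Q u * Q v > 0"
    proof (cases "Q u > 0")
      case True
      then have "odd (length (filter (\<lambda>u. Q u > 0) ws))" using less.prems Cons by simp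
      then have "filter (\<lambda>u. Q u > 0) ws \<noteq> []" by (intro notI) simp
      then obtain v where "v \<in> set ws" "Q v > 0" by (auto simp: filter_empty_conv)
      then show ?thesis using True mult_pos_pos by blast
    next
      case False
      then have neg: "Q u < 0" using u by simp
      then have "odd (length (filter (\<lambda>u. Q u < 0) ws))" using less.prems Cons by simp
      then have "filter (\<lambda>u. Q u < 0) ws \<noteq> []" by (intro notI) simp
      then obtain v where "v \<in> set ws" "Q v < 0" by (auto simp: filter_empty_conv)
      then show ?thesis using neg mult_neg_neg by blast
    qed
    then obtain v as bs where ws: "ws = as @ v # bs" and uv: "Q u * Q v > 0"
      by (metis split_list)
    have v: "Q v \<noteq> 0" using uv by auto
    let ?r = "reflection Q v"
    let ?us = "map ?r as @ bs"
    have r: "?r \<in> carrier (orthogonal_group Q)" by (rule reflection_orthogonal[OF Q v])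
    then have Qr: "Q (?r x) = Q x" for x by (simp add: orthogonal_group_def)
    have "?r \<circ> prod_reflections Q (map ?r as) = prod_reflections Q (map ?r (map ?r as)) \<circ> ?r"
      by (rule orthogonal_comp_prod_reflections[OF r])
    also have "map ?r (map ?r as) = as" by (simp add: map_idI reflection_involution[OF Q v])
    \<comment> \<open>Moving \<open>?r\<close> to the front reflects the vectors of
      \<open>as\<close> in between; reflecting them twice gives \<open>as\<close> back.\<close>
    finally have move: "prod_reflections Q as \<circ> ?r = ?r \<circ> prod_reflections Q (map ?r as)" by (rule sym)
    have "prod_reflections Q us
        = reflection Q u \<circ> (prod_reflections Q as \<circ> ?r) \<circ> prod_reflections Q bs"
      unfolding Cons ws using prod_reflections_append[of Q "u # as" "v # bs"]
      by (simp add: prod_reflections_Cons comp_assoc)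
    also have "\<dots> = (reflection Q u \<circ> ?r) \<circ> prod_reflections Q ?us"
      by (simp only: move prod_reflections_append comp_assoc)
    finally have split: "prod_reflections Q us = (reflection Q u \<circ> ?r) \<circ> prod_reflections Q ?us" .
    have "direct_isometry (isometry_group Q) (prod_reflections Q ?us)"
    proof (rule less.hyps)
      show "length ?us < length us" by (simp add: Cons ws)
      show "\<forall>x\<in>set ?us. Q x \<noteq> 0" using less.prems(1) by (auto simp: Cons ws Qr)
      have "(Q u > 0 \<and> Q v > 0) \<or> (Q u < 0 \<and> Q v < 0)" using uv by (auto simp: zero_less_mult_iff)
      then show "even (length (filter (\<lambda>u. Q u > 0) ?us))" "even (length (filter (\<lambda>u. Q u < 0) ?us))"
        using less.prems(2,3) by (auto simp: Cons ws filter_map comp_def Qr)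
    qed
    then show ?thesis
      unfolding split by (rule direct_isometry_mult[OF direct_isometry_reflection_pair[OF uv]])
  qed
qed

section \<open>Linear parts and the classification\<close>

text \<open>If \<open>x\<close> has linear part \<open>h\<close>, its square has linear part
  \<open>h \<circ> h\<close>, in which every supporting vector of a factorisation of
  \<open>h\<close> occurs twice. Translations collect on the left without affecting the linear
  part.\<close>

lemma direct_isometry_linear_part:
  assumes nd: "nondegenerate Q" and sig: "has_signature Q p q"
    and f: "direct_isometry (isometry_group Q) f"
  shows "\<exists>us t. (\<forall>u\<in>set us. Q u \<noteq> 0) \<and> f = (+) t \<circ> prod_reflections Q us \<and>
    even (length us) \<and> even (length (filter (\<lambda>u. Q u < 0) us))"
proof -
  obtain xs where xs: "set xs \<subseteq> carrier (isometry_group Q)" "f = foldr (\<circ>) (map (\<lambda>x. x \<circ> x) xs) id"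
    using f by (auto simp: direct_isometry_def isometry_group_def)
  have "\<exists>us t. (\<forall>u\<in>set us. Q u \<noteq> 0) \<and> foldr (\<circ>) (map (\<lambda>x. x \<circ> x) xs) id = (+) t \<circ> prod_reflections Q us \<and>
    even (length us) \<and> even (length (filter (\<lambda>u. Q u < 0) us))"
    using xs(1)
  proof (induction xs)
    case Nil
    then show ?case by (intro exI[of _ "[]"] exI[of _ 0]) (auto simp: prod_reflections_Nil)
  next
    case (Cons x xs)
    then have "set xs \<subseteq> carrier (isometry_group Q)" by simp
    from Cons.IH[OF this] obtain us t where us: "\<forall>u\<in>set us. Q u \<noteq> 0"
      and rest: "foldr (\<circ>) (map (\<lambda>x. x \<circ> x) xs) id = (+) t \<circ> prod_reflections Q us"
      and ev: "even (length us)" "even (length (filter (\<lambda>u. Q u < 0) us))" by blast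
    obtain h where h: "h \<in> carrier (orthogonal_group Q)" and xh: "x = (+) (x 0) \<circ> h"
      using isometry_decomposition[OF Q nd, of x] Cons.prems by auto
    obtain vs where vs: "\<forall>v\<in>set vs. Q v \<noteq> 0" and hv: "h = prod_reflections Q vs"
      using orthogonal_eq_prod_reflections[OF Q nd sig h]
      unfolding prod_reflections_def by blast
    have lin: "linear h" using h by (simp add: orthogonal_group_def)
    have xy: "x y = x 0 + h y" for y using fun_cong[OF xh, of y] by simp
    have "foldr (\<circ>) (map (\<lambda>x. x \<circ> x) (x # xs)) id = x \<circ> x \<circ> ((+) t \<circ> prod_reflections Q us)"
      by (simp only: list.map foldr_Cons comp_apply rest)
    also have "\<dots> = (+) (x 0 + h (x 0) + h (h t)) \<circ> (h \<circ> (h \<circ> prod_reflections Q us))"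
    proof
      fix y
      show "(x \<circ> x \<circ> ((+) t \<circ> prod_reflections Q us)) y
          = ((+) (x 0 + h (x 0) + h (h t)) \<circ> (h \<circ> (h \<circ> prod_reflections Q us))) y"
        using xy[of "x (t + prod_reflections Q us y)"] xy[of "t + prod_reflections Q us y"]
        by (simp add: linear_add[OF lin] add.assoc)
    qed
    also have "h \<circ> (h \<circ> prod_reflections Q us) = prod_reflections Q (vs @ vs @ us)"
      by (simp only: hv prod_reflections_append)
    finally have prod: "foldr (\<circ>) (map (\<lambda>x. x \<circ> x) (x # xs)) id
        = (+) (x 0 + h (x 0) + h (h t)) \<circ> prod_reflections Q (vs @ vs @ us)" .
    show ?case
    proof (intro exI conjI)
      show "foldr (\<circ>) (map (\<lambda>x. x \<circ> x) (x # xs)) id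
        = (+) (x 0 + h (x 0) + h (h t)) \<circ> prod_reflections Q (vs @ vs @ us)" by (rule prod)
    qed (use us vs ev in auto)
  qed
  then show ?thesis using xs(2) by simp
qed

text \<open>A direct isometry also has a factorisation with even counts, and the linear part of an
  affine map is unique, so parity uniqueness applies to the two lists. The converse composes three
  direct isometries.\<close>

lemma direct_isometry_affine_iff:
  assumes nd: "nondegenerate Q" and sig: "has_signature Q p q" and us: "\<forall>u\<in>set us. Q u \<noteq> 0"
  shows "direct_isometry (isometry_group Q) ((+) t \<circ> prod_reflections Q us \<circ> (+) s) \<longleftrightarrow>
    even (length us) \<and> even (length (filter (\<lambda>u. Q u < 0) us))"
proof
  let ?h = "prod_reflections Q us"
  assume "direct_isometry (isometry_group Q) ((+) t \<circ> ?h \<circ> (+) s)"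
  then obtain vs a where vs: "\<forall>v\<in>set vs. Q v \<noteq> 0"
    and eq: "(+) t \<circ> ?h \<circ> (+) s = (+) a \<circ> prod_reflections Q vs"
    and ev: "even (length vs)" "even (length (filter (\<lambda>u. Q u < 0) vs))"
    using direct_isometry_linear_part[OF nd sig] by blast
  have lin: "linear ?h" "linear (prod_reflections Q vs)"
    using prod_reflections_orthogonal[OF Q us] prod_reflections_orthogonal[OF Q vs]
    by (auto simp: orthogonal_group_def)
  have pt: "t + (?h s + ?h y) = a + prod_reflections Q vs y" for y
    using fun_cong[OF eq, of y] by (simp add: linear_add[OF lin(1)])
  \<comment> \<open>Evaluation at the origin identifies the translation parts, which then
    cancel.\<close>
  have "t + ?h s = a"
    using pt[of 0] linear_0[OF lin(1)] linear_0[OF lin(2)] by simp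
  then have "?h = prod_reflections Q vs"
    using pt by (intro ext) (metis add.assoc add_left_cancel)
  from even_positive_reflections_unique[OF Q nd sig us vs this]
    even_negative_reflections_unique[OF Q nd sig us vs this] ev
  \<comment> \<open>Without null vectors, the parities of the length and of the negative count
    amount to those of the positive and negative counts.\<close>
  show "even (length us) \<and> even (length (filter (\<lambda>u. Q u < 0) us))"
    using length_eq_positive_plus_negative[OF us] length_eq_positive_plus_negative[OF vs] by simp
next
  assume "even (length us) \<and> even (length (filter (\<lambda>u. Q u < 0) us))"
  then have "direct_isometry (isometry_group Q) (prod_reflections Q us)"
    using direct_isometry_prod_reflections[OF us] length_eq_positive_plus_negative[OF us] by simp
  then show "direct_isometry (isometry_group Q) ((+) t \<circ> prod_reflections Q us \<circ> (+) s)"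
    by (intro direct_isometry_mult direct_isometry_translation)
qed

lemma affine_in_isometry_group:
  assumes "\<forall>u\<in>set us. Q u \<noteq> 0"
  shows "(+) t \<circ> prod_reflections Q us \<circ> (+) s \<in> carrier (isometry_group Q)"
  using orthogonal_in_isometry_group[OF prod_reflections_orthogonal[OF Q assms]]
    monoid.m_closed[OF group.is_monoid[OF group_isometry_group[OF Q]]]
    translation_in_isometry_group[of t Q] translation_in_isometry_group[of s Q]
  by (simp add: isometry_group_def)

end

theorem theorem7:
  fixes Q :: "'v::real_vector \<Rightarrow> real" and p q :: nat
  assumes fin_dim: "\<exists>B::'v set. finite B \<and> span B = UNIV"
    and quad: "quadratic_form Q"
    and nondeg: "nondegenerate Q"
    and sig: "has_signature Q p q"
  shows
    "(\<forall>us h. (\<forall>u \<in> set us. Q u \<noteq> 0) \<and> h = foldr (\<circ>) (map (reflection Q) us) id \<longrightarrow>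
        (odd (length us) \<longrightarrow> indirect_isometry (isometry_group Q) h) \<and>
        (even (length us) \<and> even (length (filter (\<lambda>u. Q u < 0) us)) \<longrightarrow>
           direct_isometry (isometry_group Q) h) \<and>
        (even (length us) \<and> odd (length (filter (\<lambda>u. Q u < 0) us)) \<longrightarrow>
           indirect_isometry (isometry_group Q) h))
     \<and>
     (\<forall>\<tau> \<in> carrier translation_group. direct_isometry (isometry_group Q) \<tau>)
     \<and>
     (\<forall>us h. (\<forall>u \<in> set us. Q u \<noteq> 0) \<and> h = foldr (\<circ>) (map (reflection Q) us) id \<longrightarrow>
        (\<forall>\<tau> \<in> carrier translation_group. \<forall>\<sigma> \<in> carrier translation_group.
         \<forall>g \<in> {\<tau> \<circ> h, h \<circ> \<sigma>, \<tau> \<circ> h \<circ> \<sigma>}.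
           (odd (length us) \<longrightarrow> indirect_isometry (isometry_group Q) g) \<and>
           (even (length us) \<and> even (length (filter (\<lambda>u. Q u < 0) us)) \<longrightarrow>
              direct_isometry (isometry_group Q) g) \<and>
           (even (length us) \<and> odd (length (filter (\<lambda>u. Q u < 0) us)) \<longrightarrow>
              indirect_isometry (isometry_group Q) g)))"
proof -
  \<comment> \<open>All three cases come from one equivalence; membership in the group turns a
    failure to be direct into being indirect.\<close>
  have affine: "(odd (length us) \<longrightarrow> indirect_isometry (isometry_group Q) g) \<and>
      (even (length us) \<and> even (length (filter (\<lambda>u. Q u < 0) us)) \<longrightarrow>
         direct_isometry (isometry_group Q) g) \<and>
      (even (length us) \<and> odd (length (filter (\<lambda>u. Q u < 0) us)) \<longrightarrow>
         indirect_isometry (isometry_group Q) g)"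
    if "\<forall>u\<in>set us. Q u \<noteq> 0" "g = (+) t \<circ> prod_reflections Q us \<circ> (+) s" for us g t s
    using affine_in_isometry_group[OF quad that(1), of t s]
      direct_isometry_affine_iff[OF quad nondeg sig that(1), of t s]
    by (auto simp: indirect_isometry_def that(2))
  \<comment> \<open>With the zero translation on one side or both, the affine statement covers
    \<open>h\<close> itself and one-sided compositions.\<close>
  have zero: "(+) 0 = (id :: 'v \<Rightarrow> 'v)" by auto
  show ?thesis
  proof (intro conjI)
    show "\<forall>\<tau>\<in>carrier translation_group. direct_isometry (isometry_group Q) \<tau>"
      using direct_isometry_translation by (auto simp: translation_group_def)
  next
    show "\<forall>us h. (\<forall>u \<in> set us. Q u \<noteq> 0) \<and> h = foldr (\<circ>) (map (reflection Q) us) id \<longrightarrow>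
        (odd (length us) \<longrightarrow> indirect_isometry (isometry_group Q) h) \<and>
        (even (length us) \<and> even (length (filter (\<lambda>u. Q u < 0) us)) \<longrightarrow>
           direct_isometry (isometry_group Q) h) \<and>
        (even (length us) \<and> odd (length (filter (\<lambda>u. Q u < 0) us)) \<longrightarrow>
           indirect_isometry (isometry_group Q) h)"
      (is "\<forall>us h. ?P us h \<longrightarrow> ?R us h")
    proof (intro allI impI)
      fix us h assume P: "?P us h"
      show "?R us h" by (rule affine[of _ _ 0 0]) (use P zero in \<open>auto simp: prod_reflections_def\<close>)
    qed
  next
    show "\<forall>us h. (\<forall>u \<in> set us. Q u \<noteq> 0) \<and> h = foldr (\<circ>) (map (reflection Q) us) id \<longrightarrow>
        (\<forall>\<tau> \<in> carrier translation_group. \<forall>\<sigma> \<in> carrier translation_group.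
         \<forall>g \<in> {\<tau> \<circ> h, h \<circ> \<sigma>, \<tau> \<circ> h \<circ> \<sigma>}.
           (odd (length us) \<longrightarrow> indirect_isometry (isometry_group Q) g) \<and>
           (even (length us) \<and> even (length (filter (\<lambda>u. Q u < 0) us)) \<longrightarrow>
              direct_isometry (isometry_group Q) g) \<and>
           (even (length us) \<and> odd (length (filter (\<lambda>u. Q u < 0) us)) \<longrightarrow>
              indirect_isometry (isometry_group Q) g))"
      (is "\<forall>us h. ?P us h \<longrightarrow> (\<forall>\<tau>\<in>_. \<forall>\<sigma>\<in>_. \<forall>g\<in>_. ?R us g)")
    proof (intro allI impI ballI)
      fix us h \<tau> \<sigma> g
      assume P: "?P us h" and "\<tau> \<in> carrier translation_group" "\<sigma> \<in> carrier translation_group"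
        and g: "g \<in> {\<tau> \<circ> h, h \<circ> \<sigma>, \<tau> \<circ> h \<circ> \<sigma>}"
      then obtain t s where "\<tau> = (+) t" "\<sigma> = (+) s" by (auto simp: translation_group_def)
      with g zero have "g = (+) t \<circ> h \<circ> (+) 0 \<or> g = (+) 0 \<circ> h \<circ> (+) s \<or> g = (+) t \<circ> h \<circ> (+) s"
        by auto
      then obtain t' s' where "g = (+) t' \<circ> h \<circ> (+) s'" by blast
      then show "?R us g" by (intro affine[of _ _ t' s']) (use P in \<open>auto simp: prod_reflections_def\<close>)
    qed
  qed
qed

end
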